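(* Let $0<\alpha\le1$ and let $p_k^\alpha(n,t)$, $n\ge0$, $k\ge0$, $t\ge0$, be the Adomian series components of the state probabilities of the fractional birth-death process with rates $\lambda_n,\mu_n$, and let $\psi_{n,k}=\psi_{n,k}\big((\lambda_j)_1^{a_{n,k}},(\mu_j)_1^{b_{n,k}}\big)$ be the functions of $\lambda_1,\dots,\lambda_{a_{n,k}},\mu_1,\dots,\mu_{b_{n,k}}$ defined recursively in the context. Then for all $t\ge0$, $$p_k^\alpha(n,t)=\begin{cases}(-1)^{k+1}\psi_{0,k}\,\dfrac{t^{k\alpha}}{\Gamma(k\alpha+1)}, & n=0,\ k\ge1,\\[2mm] (-1)^{k-n+1}\psi_{n,k}\,\dfrac{t^{k\alpha}}{\Gamma(k\alpha+1)}, & n\ge1,\ n-k<1,\\[2mm] \Big(\prod_{j=1}^{n-1}\lambda_j\Big)\dfrac{t^{k\alpha}}{\Gamma(k\alpha+1)}, & n\ge1,\ n-k=1,\\[2mm] 0, & n=k=0\ \text{or}\ n-k>1,\end{cases}$$ where an empty product equals $1$.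
   Context: Rates: $\lambda_0=\mu_0=0$ and $\lambda_n,\mu_n\ge0$ for $n\ge1$; $\Lambda_n=\lambda_n+\mu_n$. $I_t^\alpha g(t)=\frac{1}{\Gamma(\alpha)}\int_0^t (t-s)^{\alpha-1}g(s)\,\mathrm{d}s$ is the Riemann–Liouville fractional integral. The series components are defined recursively by $p_0^\alpha(1,t)=1$, $p_0^\alpha(n,t)=0$ for $n\ne1$, and for $k\ge1$, $n\ge0$, $$p_k^\alpha(n,t)=I_t^\alpha\big(-(\lambda_n+\mu_n)p_{k-1}^\alpha(n,t)+\lambda_{n-1}p_{k-1}^\alpha(n-1,t)+\mu_{n+1}p_{k-1}^\alpha(n+1,t)\big),$$ with $p_k^\alpha(-1,t)=0$ for all $k$. With $[\cdot]$ the greatest integer function, $a_{n,k}=\left[\frac{n+k}{2}\right]$, and $b_{n,k}=\left[\frac{n+k+1}{2}\right]$ if $n-k\ne1$, $b_{n,k}=0$ if $n-k=1$. The functions $\psi_{n,k}$, $n,k\ge0$, are defined by $\psi_{0,0}=0$, $\psi_{1,0}=1$, $\psi_{n,0}=0$ for $n\ge2$, $\psi_{0,1}=\mu_1$, and, for $k\ge0$, $$\psi_{n,k+1}=\begin{cases}0,& n>k+2,\\ \mu_1\psi_{1,k},& n=0,\ k\ge1,\\ \Lambda_1\psi_{1,k}+\mu_2\psi_{2,k},& n=1,\ k\ge0,\\ \Lambda_n\psi_{n,k}+\lambda_{n-1}\psi_{n-1,k}+\mu_{n+1}\psi_{n+1,k},& n\ge2,\ k>n-2,\\ \lambda_1\lambda_2\cdots\lambda_{n-1},&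 n\ge2,\ n-k=2.\end{cases}$$ *)

theory Defs
  imports "HOL-Analysis.Analysis"
begin

(* Lebesgue integral over [0,t].  At s = t the kernel takes the junk value 0 powr (alpha - 1) = 0,
   on a null set. *)
definition RL_integral :: "real \<Rightarrow> (real \<Rightarrow> real) \<Rightarrow> real \<Rightarrow> real" where
  "RL_integral \<alpha> g t =
     1 / Gamma \<alpha> * (LBINT s:{0..t}. (t - s) powr (\<alpha> - 1) * g s)"

(* Real power with t^0 = 1 also at t = 0; in the library 0 powr 0 = 0. *)
definition rpow :: "real \<Rightarrow> real \<Rightarrow> real" where
  "rpow t x = (if x = 0 then 1 else t powr x)"

(* adomian alpha lam mu k n t is p_k^alpha(n,t).  The term with index n - 1 is absent for n = 0,
   which is the convention p_k^alpha(-1,t) = 0. *)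
primrec adomian ::
  "real \<Rightarrow> (nat \<Rightarrow> real) \<Rightarrow> (nat \<Rightarrow> real) \<Rightarrow> nat \<Rightarrow> nat \<Rightarrow> real \<Rightarrow> real" where
  "adomian \<alpha> lam mu 0 = (\<lambda>n t. if n = 1 then 1 else 0)"
| "adomian \<alpha> lam mu (Suc k) = (\<lambda>n. RL_integral \<alpha> (\<lambda>s.
       - (lam n + mu n) * adomian \<alpha> lam mu k n s
       + (if n = 0 then 0 else lam (n - 1) * adomian \<alpha> lam mu k (n - 1) s)
       + mu (n + 1) * adomian \<alpha> lam mu k (n + 1) s))"

definition a_idx :: "nat \<Rightarrow> nat \<Rightarrow> nat" where
  "a_idx n k = (n + k) div 2"

definition b_idx :: "nat \<Rightarrow> nat \<Rightarrow> nat" where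
  "b_idx n k = (if int n - int k \<noteq> 1 then (n + k + 1) div 2 else 0)"

(* psi takes the whole rate sequences; that psi_{n,k} depends only on lam_1, ..., lam_{a_{n,k}} and
   mu_1, ..., mu_{b_{n,k}} is a property of the recursion. In the successor equation the last
   branch is the case n >= 2, k > n - 2. *)
primrec psi :: "(nat \<Rightarrow> real) \<Rightarrow> (nat \<Rightarrow> real) \<Rightarrow> nat \<Rightarrow> nat \<Rightarrow> real" where
  "psi lam mu n 0 = (if n = 1 then 1 else 0)"
| "psi lam mu n (Suc k) =
     (if n > k + 2 then 0
      else if n = 0 then (if k = 0 then mu 1 else mu 1 * psi lam mu 1 k)
      else if n = 1 then (lam 1 + mu 1) * psi lam mu 1 k + mu 2 * psi lam mu 2 k
      else if n = k + 2 then (\<Prod>j=1..n - 1. lam j)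
      else (lam n + mu n) * psi lam mu n k + lam (n - 1) * psi lam mu (n - 1) k
             + mu (n + 1) * psi lam mu (n + 1) k)"

end

theory Submission
  imports Defs
begin

text \<open>
  The Riemann--Liouville integral raises a normalised power
  \<open>t powr b / Gamma (b + 1)\<close> to \<open>t powr (b + \<alpha>) / Gamma (b + \<alpha> + 1)\<close>; after rescaling the
  interval to the unit interval this is Euler's Beta integral.  Hence every component
  \<open>adomian \<alpha> lam mu k n\<close> is a constant \<open>c n k\<close> times the \<open>k\<close>-th normalised power, and the fractional
  integral equation turns into a purely algebraic recursion
  \<open>c n (k + 1) = - (lam n + mu n) c n k + lam (n - 1) c (n - 1) k + mu (n + 1) c (n + 1) k\<close>
  that does not involve \<open>\<alpha>\<close>.

  In the substitution \<open>c n k = (-1) ^ (n + k + 1) * psi n k\<close>, the sign at \<open>(n, k + 1)\<close> agrees with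
  the signs at \<open>(n - 1, k)\<close> and \<open>(n + 1, k)\<close> and is opposite to the sign at \<open>(n, k)\<close>, which
  cancels the minus in front of the diagonal term.  So \<open>psi\<close> obeys the same recursion with plus
  signs throughout.  When \<open>lam 0\<close> and \<open>mu 0\<close> vanish, all branches of the definition of \<open>psi\<close> are
  instances of it (lemma \<open>psi_Suc\<close>): starting from state 1, one step of the recursion climbs at
  most one state, so \<open>psi n k\<close> vanishes above the line \<open>n = k + 1\<close>, and on that line every
  step is a birth, which gives the product of the birth rates.  The resulting closed formula
  (lemma \<open>adomian_eq_psi\<close>) covers all \<open>n\<close> and \<open>k\<close> at once, and the cases of the theorem are its
  restrictions to, below and above the line.

  The same picture bounds the rates that occur: \<open>psi n k\<close> is a sum over paths of \<open>k\<close> steps from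
  1 to \<open>n\<close>, and reaching a high state and returning costs steps (lemma \<open>psi_cong\<close>).
\<close>

section \<open>Fractional integrals of powers\<close>

text \<open>
  For a nonnegative integrand both the Bochner and the gauge integral equal the nonnegative
  Lebesgue integral.  This transfers the Beta integral, a gauge integral, to the Lebesgue integral
  in the fractional integral, without a separate proof of integrability.
\<close>

lemma set_integral_lborel_eq_has_integral_nonneg:
  fixes f :: "'a::euclidean_space \<Rightarrow> real"
  assumes meas: "set_borel_measurable borel A f"
    and nonneg: "\<And>x. x \<in> A \<Longrightarrow> 0 \<le> f x"
    and I: "(f has_integral I) A"
  shows "(LINT x:A|lborel. f x) = I"
proof -
  have I0: "0 \<le> I"
    using has_integral_nonneg[OF I] nonneg by blast
  have "(LINT x:A|lborel. f x) = (\<integral>x. indicator A x * f x \<partial>lborel)"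
    by (simp add: set_lebesgue_integral_def)
  also have "\<dots> = enn2real (\<integral>\<^sup>+x. ennreal (indicator A x * f x) \<partial>lborel)"
    using meas nonneg
    by (intro integral_eq_nn_integral)
       (auto simp: set_borel_measurable_def indicator_def)
  also have "\<dots> = I"
    using nn_integral_has_integral_lebesgue[OF nonneg I] I0 by simp
  finally show ?thesis .
qed

lemma has_integral_Beta_scaled:
  fixes a b t :: real
  assumes a: "0 < a" and b: "0 < b" and t: "0 < t"
  shows "((\<lambda>s. s powr (a - 1) * (t - s) powr (b - 1)) has_integral
           t powr (a + b - 1) * Beta a b) {0..t}"
proof -
  let ?f = "\<lambda>s. s powr (a - 1) * (1 - s) powr (b - 1)"
  have "((\<lambda>s. ?f ((1 / t) *\<^sub>R s + 0)) has_integral (Beta a b /\<^sub>R (1 / t) ^ DIM(real)))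
          (cbox ((0 - 0) /\<^sub>R (1 / t)) ((1 - 0) /\<^sub>R (1 / t)))"
    using has_integral_Beta_real[OF a b] t
    by (intro has_integral_affinity') auto
  hence "((\<lambda>s. ?f (s / t)) has_integral t * Beta a b) {0..t}"
    using t by simp
  hence "((\<lambda>s. t powr (a + b - 2) * ?f (s / t)) has_integral
           t powr (a + b - 2) * (t * Beta a b)) {0..t}"
    by (rule has_integral_mult_right)
  also have "t powr (a + b - 2) * (t * Beta a b) = t powr (a + b - 1) * Beta a b"
    using t powr_add[of t "a + b - 2" 1] by simp
  finally have scaled: "((\<lambda>s. t powr (a + b - 2) * ?f (s / t)) has_integral
                          t powr (a + b - 1) * Beta a b) {0..t}" .
  show ?thesis
  proof (rule has_integral_eq[OF _ scaled])
    fix s assume s: "s \<in> {0..t}"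
    have "1 - s / t = (t - s) / t"
      using t by (simp add: field_simps)
    moreover have "t powr (a + b - 2) = t powr (a - 1) * t powr (b - 1)"
      by (simp flip: powr_add)
    ultimately show "t powr (a + b - 2) * ?f (s / t) = s powr (a - 1) * (t - s) powr (b - 1)"
      using s t by (simp add: powr_divide)
  qed
qed

lemma RL_integral_cong:
  assumes "\<And>s. 0 \<le> s \<Longrightarrow> s \<le> t \<Longrightarrow> f s = g s"
  shows "RL_integral \<alpha> f t = RL_integral \<alpha> g t"
  unfolding RL_integral_def using assms
  by (auto intro!: arg_cong[where f = "\<lambda>x. 1 / Gamma \<alpha> * x"] set_lebesgue_integral_cong)

lemma RL_integral_cmult: "RL_integral \<alpha> (\<lambda>s. c * f s) t = c * RL_integral \<alpha> f t"
proof -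
  have "(\<lambda>s. (t - s) powr (\<alpha> - 1) * (c * f s)) = (\<lambda>s. c * ((t - s) powr (\<alpha> - 1) * f s))"
    by (auto simp: mult_ac)
  thus ?thesis
    by (simp add: RL_integral_def)
qed

text \<open>
  The quotient of \<open>Gamma\<close> values in the Beta function is exactly the change of normalisation, and
  its factor \<open>Gamma \<alpha>\<close> is cancelled by the prefactor of the fractional integral.
\<close>

lemma RL_integral_rpow:
  fixes \<alpha> b t :: real
  assumes \<alpha>: "0 < \<alpha>" and b: "0 \<le> b" and t: "0 \<le> t"
  shows "RL_integral \<alpha> (\<lambda>s. rpow s b / Gamma (b + 1)) t = rpow t (b + \<alpha>) / Gamma (b + \<alpha> + 1)"
proof (cases "t = 0")
  case True
  have "(LBINT s:{0..0}. (0 - s) powr (\<alpha> - 1) * (rpow s b / Gamma (b + 1))) = 0"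
    by (rule set_integral_lborel_eq_has_integral_nonneg)
       (auto simp: set_borel_measurable_def rpow_def has_integral_refl intro!: divide_nonneg_pos
        Gamma_real_pos b)
  thus ?thesis
    using True \<alpha> b by (auto simp: RL_integral_def rpow_def)
next
  case False
  hence t0: "0 < t"
    using t by simp
  have Gb: "Gamma (b + 1) > 0" and Ga: "Gamma \<alpha> > 0"
    using \<alpha> b by (auto intro!: Gamma_real_pos)
  hence nz: "Gamma (b + 1) \<noteq> 0" "Gamma \<alpha> \<noteq> 0"
    by linarith+
  have Beta: "((\<lambda>s. s powr b * (t - s) powr (\<alpha> - 1)) has_integral
                t powr (b + \<alpha>) * Beta (b + 1) \<alpha>) {0..t}"
    using has_integral_Beta_scaled[of "b + 1" \<alpha> t] \<alpha> b t0 by (simp add: algebra_simps)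
  \<comment> \<open>\<open>rpow s 0\<close> and \<open>s powr 0\<close> differ at \<open>s = 0\<close>, which is a null set.\<close>
  have "((\<lambda>s. rpow s b * (t - s) powr (\<alpha> - 1)) has_integral
           t powr (b + \<alpha>) * Beta (b + 1) \<alpha>) {0..t}"
    by (rule has_integral_spike_finite[of "{0}", OF _ _ Beta]) (auto simp: rpow_def)
  hence "((\<lambda>s. (1 / Gamma (b + 1)) * (rpow s b * (t - s) powr (\<alpha> - 1))) has_integral
           (1 / Gamma (b + 1)) * (t powr (b + \<alpha>) * Beta (b + 1) \<alpha>)) {0..t}"
    by (rule has_integral_mult_right)
  hence HI: "((\<lambda>s. (t - s) powr (\<alpha> - 1) * (rpow s b / Gamma (b + 1))) has_integral
           (1 / Gamma (b + 1)) * (t powr (b + \<alpha>) * Beta (b + 1) \<alpha>)) {0..t}"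
    by (simp add: mult_ac)
  have "(LBINT s:{0..t}. (t - s) powr (\<alpha> - 1) * (rpow s b / Gamma (b + 1))) =
           (1 / Gamma (b + 1)) * (t powr (b + \<alpha>) * Beta (b + 1) \<alpha>)"
  proof (rule set_integral_lborel_eq_has_integral_nonneg[OF _ _ HI])
    show "set_borel_measurable borel {0..t}
            (\<lambda>s. (t - s) powr (\<alpha> - 1) * (rpow s b / Gamma (b + 1)))"
      unfolding set_borel_measurable_def rpow_def by (cases "b = 0") simp_all
  qed (use Gb in \<open>auto simp: rpow_def\<close>)
  thus ?thesis
    using nz \<alpha> b by (simp add: RL_integral_def rpow_def Beta_def add_ac)
qed

section \<open>The coefficient functions\<close>

lemma psi_eq_0: "n > k + 1 \<or> (n = 0 \<and> k = 0) \<Longrightarrow> psi lam mu n k = 0"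
  by (cases k) auto

lemma psi_diagonal: "psi lam mu (Suc k) k = (\<Prod>j=1..k. lam j)"
  by (induction k) auto

text \<open>
  The rates at state 0 vanish, so the terms that the definition of \<open>psi\<close> leaves out for
  \<open>n \<le> 1\<close> may be added; the terms that it leaves out for \<open>n \<ge> k + 2\<close> vanish, or are the product of
  the birth rates.
\<close>

lemma psi_Suc:
  assumes "lam 0 = 0" "mu 0 = 0"
  shows "psi lam mu n (Suc k) =
           (lam n + mu n) * psi lam mu n k
             + (if n = 0 then 0 else lam (n - 1) * psi lam mu (n - 1) k)
             + mu (n + 1) * psi lam mu (n + 1) k"
proof -
  consider "n > k + 2" | "n = 0" | "n = 1" | "n = k + 2" | "2 \<le> n" "n < k + 2"
    by linarith
  thus ?thesis
  proof cases
    case 1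
    thus ?thesis by (simp add: psi_eq_0)
  next
    case 4
    hence "n - 1 = Suc k"
      by simp
    hence "psi lam mu (n - 1) k = (\<Prod>j=1..k. lam j)"
      by (simp only: psi_diagonal)
    moreover have "psi lam mu n k = 0" "psi lam mu (n + 1) k = 0"
      using 4 by (auto intro!: psi_eq_0)
    ultimately show ?thesis
      using 4 by (simp add: mult.commute)
  qed (use assms in \<open>auto simp: numeral_2_eq_2\<close>)
qed

text \<open>
  A path from 1 to \<open>n\<close> in \<open>k\<close> steps that pauses at \<open>j\<close> or rises from \<open>j\<close> takes at least
  \<open>2 * j - n\<close> steps, and one that descends from \<open>j\<close> takes at least \<open>2 * j - n - 1\<close>; this is what
  \<open>a_idx\<close> and \<open>b_idx\<close> count.  On the line \<open>n = k + 1\<close> all steps are births, hence no death rate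
  occurs.
\<close>

lemma psi_cong:
  assumes "\<forall>j\<in>{1..a_idx n k}. lam' j = lam j" "\<forall>j\<in>{1..b_idx n k}. mu' j = mu j"
  shows "psi lam' mu' n k = psi lam mu n k"
  using assms
proof (induction k arbitrary: n)
  case 0
  thus ?case by simp
next
  case (Suc k)
  have lam: "lam' j = lam j" if "1 \<le> j" "2 * j \<le> n + k + 1" for j
    using Suc.prems(1) that by (auto simp: a_idx_def)
  have mu: "mu' j = mu j" if "1 \<le> j" "2 * j \<le> n + k + 2" "n \<noteq> k + 2" for j
    using Suc.prems(2) that by (auto simp: b_idx_def)
  have IH: "psi lam' mu' m k = psi lam mu m k" if "m \<le> n + 1" "n \<noteq> k + 2" for m
    using that by (intro Suc.IH ballI lam mu) (auto simp: a_idx_def b_idx_def split: if_splits)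
  consider "n > k + 2" | "n = k + 2" | "n = 0" | "n = 1" | "2 \<le> n" "n = k + 1" | "2 \<le> n" "n < k + 1"
    by linarith
  thus ?case
  proof cases
    case 2
    hence "(\<Prod>j=1..n - 1. lam' j) = (\<Prod>j=1..n - 1. lam j)"
      by (intro prod.cong lam) auto
    with 2 show ?thesis by simp
  next
    case 3
    with mu[of 1] IH[of 1] show ?thesis by simp
  next
    case 4
    have "mu' 2 * psi lam mu 2 k = mu 2 * psi lam mu 2 k"
      using 4 mu[of 2] by (cases "k = 0") auto
    with 4 mu[of 1] lam[of 1] IH[of 1] IH[of 2] show ?thesis by simp
  next
    case 5
    hence "psi lam mu (n + 1) k = 0"
      by (intro psi_eq_0) auto
    with 5 mu[of n] lam[of n] lam[of "n - 1"] IH[of n] IH[of "n - 1"] IH[of "n + 1"]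
    show ?thesis by simp
  next
    case 6
    with mu[of n] mu[of "n + 1"] lam[of n] lam[of "n - 1"] IH[of n] IH[of "n - 1"] IH[of "n + 1"]
    show ?thesis by simp
  qed simp
qed

section \<open>The series components\<close>

lemma adomian_eq_psi:
  assumes \<alpha>: "0 < \<alpha>" and zero: "lam 0 = 0" "mu 0 = 0" and t: "0 \<le> t"
  shows "adomian \<alpha> lam mu k n t =
           (-1) ^ (n + k + 1) * psi lam mu n k * (rpow t (real k * \<alpha>) / Gamma (real k * \<alpha> + 1))"
  using t
proof (induction k arbitrary: n t)
  case 0
  thus ?case by (simp add: rpow_def)
next
  case (Suc k)
  let ?c = "\<lambda>m. (-1) ^ (m + k + 1) * psi lam mu m k"
  let ?C = "- (lam n + mu n) * ?c n + (if n = 0 then 0 else lam (n - 1) * ?c (n - 1))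
              + mu (n + 1) * ?c (n + 1)"
  have "adomian \<alpha> lam mu (Suc k) n t =
          RL_integral \<alpha> (\<lambda>s. ?C * (rpow s (real k * \<alpha>) / Gamma (real k * \<alpha> + 1))) t"
    unfolding adomian.simps
  proof (rule RL_integral_cong)
    fix s :: real assume "0 \<le> s"
    from Suc.IH[OF this]
    show "- (lam n + mu n) * adomian \<alpha> lam mu k n s
            + (if n = 0 then 0 else lam (n - 1) * adomian \<alpha> lam mu k (n - 1) s)
            + mu (n + 1) * adomian \<alpha> lam mu k (n + 1) s =
          ?C * (rpow s (real k * \<alpha>) / Gamma (real k * \<alpha> + 1))"
      by (simp only: distrib_right mult.assoc if_distrib[of "\<lambda>x. x * _"] mult_zero_left)
  qed
  also have "\<dots> = ?C * (rpow t (real (Suc k) * \<alpha>) / Gamma (real (Suc k) * \<alpha> + 1))"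
    using RL_integral_rpow[OF \<alpha>, of "real k * \<alpha>" t] \<alpha> Suc.prems
    by (simp only: RL_integral_cmult) (simp add: algebra_simps)
  also have "?C = (-1) ^ (n + Suc k + 1) * psi lam mu n (Suc k)"
    unfolding psi_Suc[of lam mu, OF zero]
    by (cases n) (simp_all add: algebra_simps del: psi.simps)
  finally show ?case .
qed

theorem theorem3p2:
  fixes \<alpha> t :: real and lam mu :: "nat \<Rightarrow> real" and n k :: nat
  assumes "0 < \<alpha>" and "\<alpha> \<le> 1"
    and "lam 0 = 0" and "mu 0 = 0"
    and "\<And>j. 1 \<le> j \<Longrightarrow> 0 \<le> lam j" and "\<And>j. 1 \<le> j \<Longrightarrow> 0 \<le> mu j"
    and "0 \<le> t"
  shows "(\<forall>lam' mu'. (\<forall>j\<in>{1..a_idx n k}. lam' j = lam j) \<longrightarrow> (\<forall>j\<in>{1..b_idx n k}. mu' j = mu j)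
            \<longrightarrow> psi lam' mu' n k = psi lam mu n k)
    \<and> (n = 0 \<and> 1 \<le> k \<longrightarrow>
         adomian \<alpha> lam mu k n t
           = (-1) ^ (k + 1) * psi lam mu 0 k * (rpow t (real k * \<alpha>) / Gamma (real k * \<alpha> + 1)))
    \<and> (1 \<le> n \<and> int n - int k < 1 \<longrightarrow>
         adomian \<alpha> lam mu k n t
           = (-1) ^ (k - n + 1) * psi lam mu n k * (rpow t (real k * \<alpha>) / Gamma (real k * \<alpha> + 1)))
    \<and> (1 \<le> n \<and> int n - int k = 1 \<longrightarrow>
         adomian \<alpha> lam mu k n t
           = (\<Prod>j=1..n - 1. lam j) * (rpow t (real k * \<alpha>) / Gamma (real k * \<alpha> + 1)))
    \<and> ((n = 0 \<and> k = 0) \<or> int n - int k > 1 \<longrightarrow> adomian \<alpha> lam mu k n t = 0)"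
proof -
  note closed_form = adomian_eq_psi[of \<alpha> lam mu, OF assms(1,3,4,7)]
  have sign: "(-1::real) ^ (k - n) = (-1) ^ (n + k)" if "n \<le> k"
  proof -
    have "n + k = k - n + 2 * n"
      using that by simp
    thus ?thesis by (simp only: power_add power_mult) simp
  qed
  have diagonal: "(-1) ^ (n + k + 1) * psi lam mu n k = (\<Prod>j=1..n - 1. lam j)" if "n = Suc k"
    unfolding that psi_diagonal by simp
  show ?thesis
  proof (intro conjI)
    show "1 \<le> n \<and> int n - int k = 1 \<longrightarrow> adomian \<alpha> lam mu k n t
            = (\<Prod>j=1..n - 1. lam j) * (rpow t (real k * \<alpha>) / Gamma (real k * \<alpha> + 1))"
    proof
      assume "1 \<le> n \<and> int n - int k = 1"
      hence "n = Suc k"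
        by linarith
      from diagonal[OF this] show "adomian \<alpha> lam mu k n t
            = (\<Prod>j=1..n - 1. lam j) * (rpow t (real k * \<alpha>) / Gamma (real k * \<alpha> + 1))"
        by (simp only: closed_form)
    qed
  qed (auto simp: closed_form sign psi_eq_0 intro: psi_cong)
qed

end
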